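(* Let $\theta>0$, let $\nu_0$ be a probability measure on a space $S$, let $n,m\ge 0$ be integers, and let $X_1,\ldots,X_n\in S$. Given $X_1,\ldots,X_n$, let $Y_1,\ldots,Y_m$ be generated by the Pólya-urn scheme with base measure $\theta\nu_0+\sum_{i=1}^n\delta_{X_i}$, and let $R$ be the number of distinct indices $i\in\{1,\ldots,n\}$ such that at least one of $Y_1,\ldots,Y_m$ originates from $X_i$ (see context). Then, for every $r\in\{0,\ldots,\min\{n,m\}\}$, the conditional probability $P(r\mid m,n)$ that $R=r$ is $$P(r\mid m,n)=\frac{n_{[r]}\,(\theta+r)_{(m-r)}}{(\theta+n)_{(m)}}\,C(m,r),$$ which can be written as $$P(r\mid m,n)=r!\,C(n,r)\,C(m,r)\,\frac{\theta_{(n)}\,\theta_{(m)}}{\theta_{(n+m)}\,\theta_{(r)}}.$$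
   Context: Notation: $a_{(k)}=a(a+1)\cdots(a+k-1)$ for $k\ge1$, $a_{(0)}=1$; $a_{[k]}=a(a-1)\cdots(a-k+1)$ for $k\ge1$, $a_{[0]}=1$; $C(m,n)=\frac{m!}{(m-n)!\,n!}$; $\delta_x$ is the point mass at $x$. Pólya-urn scheme: for $j=1,\ldots,m$, conditionally on $X_1,\ldots,X_n$ and $Y_1,\ldots,Y_{j-1}$, the variable $Y_j$ has distribution $$\frac{\theta\nu_0+\sum_{i=1}^n\delta_{X_i}+\sum_{l=1}^{j-1}\delta_{Y_l}}{\theta+n+j-1}.$$ The draw is understood as a mixture: with probability $\theta/(\theta+n+j-1)$ the value $Y_j$ is a fresh draw from $\nu_0$; with probability $1/(\theta+n+j-1)$ for each $i\in\{1,\ldots,n\}$ it is a copy of $X_i$; with probability $1/(\theta+n+j-1)$ for each $l\in\{1,\ldots,j-1\}$ it is a copy of $Y_l$. Origin: $Y_j$ originates from $X_i$ if it is a copy of $X_i$, or a copy of some $Y_l$ ($l<j$) that itself originates from $X_i$; a fresh draw from $\nu_0$ (and any copy descending from it) originates from none of the $X_i$. Indices, not values, are counted: for example, if the $Y_j$'s originating from the $X$'s originate from $X_2,X_4,X_2,X_1,X_6,X_4$, then the distinct indices are $\{1,2,4,6\}$ and $R=4$. *)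

theory Defs
  imports "HOL-Probability.Probability"
begin

definition falling :: "real \<Rightarrow> nat \<Rightarrow> real" where
  "falling a k = (\<Prod>i<k. a - real i)"

text \<open>
  How a variable of the urn scheme is drawn: afresh from the base measure, as a copy of
  \<open>X i\<close>, or as a copy of \<open>Y l\<close>. The indices of the \<open>X\<close>s and \<open>Y\<close>s start at 1.
\<close>

datatype draw = Fresh | CopyX nat | CopyY nat

definition urn_past ::
  "'w measure \<Rightarrow> 's measure \<Rightarrow> (nat \<Rightarrow> 'w \<Rightarrow> draw) \<Rightarrow> (nat \<Rightarrow> 'w \<Rightarrow> 's) \<Rightarrow> nat \<Rightarrow> 'w measure" where
  "urn_past M \<nu>0 D Y j =
     vimage_algebra (space M) (\<lambda>\<omega>. \<lambda>l\<in>{1..<j}. (D l \<omega>, Y l \<omega>))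
       (PiM {1..<j} (\<lambda>_. count_space UNIV \<Otimes>\<^sub>M \<nu>0))"

text \<open>
  The urn scheme for fixed points \<open>X 1, \<dots>, X n\<close>. The random variable \<open>D j\<close> records the way
  in which \<open>Y j\<close> is drawn. The past of step \<open>j\<close> consists of the values \<open>Y l\<close> and of the
  choices \<open>D l\<close> for \<open>l < j\<close>: the values alone do not determine the choices (two of them may
  coincide), so a law given the values only would not determine the joint law of the choices.
\<close>

locale polya_urn = prob_space M
  for M :: "'w measure" +
  fixes \<theta> :: real and \<nu>0 :: "'s measure" and n :: nat and X :: "nat \<Rightarrow> 's"
    and m :: nat and D :: "nat \<Rightarrow> 'w \<Rightarrow> draw" and Y :: "nat \<Rightarrow> 'w \<Rightarrow> 's"
  assumes measurable_D: "\<And>j. j \<in> {1..m} \<Longrightarrow> D j \<in> measurable M (count_space UNIV)"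
    and measurable_Y: "\<And>j. j \<in> {1..m} \<Longrightarrow> Y j \<in> measurable M \<nu>0"
    and fresh: "\<And>j B. j \<in> {1..m} \<Longrightarrow> B \<in> sets \<nu>0 \<Longrightarrow>
      AE \<omega> in M. real_cond_exp M (urn_past M \<nu>0 D Y j)
          (indicator {\<omega> \<in> space M. D j \<omega> = Fresh \<and> Y j \<omega> \<in> B}) \<omega>
        = \<theta> / (\<theta> + real n + real j - 1) * measure \<nu>0 B"
    and copy_X: "\<And>j i. j \<in> {1..m} \<Longrightarrow> i \<in> {1..n} \<Longrightarrow>
      AE \<omega> in M. real_cond_exp M (urn_past M \<nu>0 D Y j)
          (indicator {\<omega> \<in> space M. D j \<omega> = CopyX i}) \<omega>
        = 1 / (\<theta> + real n + real j - 1)"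
    and copy_Y: "\<And>j l. j \<in> {1..m} \<Longrightarrow> l \<in> {1..<j} \<Longrightarrow>
      AE \<omega> in M. real_cond_exp M (urn_past M \<nu>0 D Y j)
          (indicator {\<omega> \<in> space M. D j \<omega> = CopyY l}) \<omega>
        = 1 / (\<theta> + real n + real j - 1)"
    and value_X: "\<And>j i. j \<in> {1..m} \<Longrightarrow> i \<in> {1..n} \<Longrightarrow>
      AE \<omega> in M. D j \<omega> = CopyX i \<longrightarrow> Y j \<omega> = X i"
    and value_Y: "\<And>j l. j \<in> {1..m} \<Longrightarrow> l \<in> {1..<j} \<Longrightarrow>
      AE \<omega> in M. D j \<omega> = CopyY l \<longrightarrow> Y j \<omega> = Y l \<omega>"

text \<open>\<open>originates d j i\<close>: under the choices \<open>d\<close>, the \<open>j\<close>-th draw originates from \<open>X i\<close>.\<close>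

inductive originates :: "(nat \<Rightarrow> draw) \<Rightarrow> nat \<Rightarrow> nat \<Rightarrow> bool" for d :: "nat \<Rightarrow> draw" where
  copy_of_X: "d j = CopyX i \<Longrightarrow> originates d j i"
| copy_of_Y: "d j = CopyY l \<Longrightarrow> l \<in> {1..<j} \<Longrightarrow> originates d l i \<Longrightarrow> originates d j i"

definition num_origins :: "nat \<Rightarrow> nat \<Rightarrow> (nat \<Rightarrow> draw) \<Rightarrow> nat" where
  "num_origins n m d = card {i \<in> {1..n}. \<exists>j\<in>{1..m}. originates d j i}"

text \<open>
  The scheme has the usual predictive law: given the past, \<open>Y j\<close> is distributed according to the
  normalised sum of \<open>\<theta> \<nu>0\<close> and of the point masses at the \<open>X i\<close> and at the earlier \<open>Y l\<close>.
\<close>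

context polya_urn
begin

lemma finite_measure_subalgebra_urn_past:
  assumes "j \<in> {1..m}"
  shows "finite_measure_subalgebra M (urn_past M \<nu>0 D Y j)"
proof -
  have f: "(\<lambda>\<omega>. \<lambda>l\<in>{1..<j}. (D l \<omega>, Y l \<omega>))
      \<in> measurable M (PiM {1..<j} (\<lambda>_. count_space UNIV \<Otimes>\<^sub>M \<nu>0))"
    using assms by (intro measurable_restrict measurable_Pair measurable_D measurable_Y) auto
  have "subalgebra M (urn_past M \<nu>0 D Y j)"
    unfolding subalgebra_def urn_past_def
    using measurable_sets[OF f] measurable_space[OF f]
    by (subst sets_vimage_algebra2) (auto simp del: space_PiM)
  then show ?thesis
    by unfold_locales
qed

lemma urn_past_Y:
  assumes "l \<in> {1..<j}" "j \<in> {1..m}"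
  shows "Y l \<in> measurable (urn_past M \<nu>0 D Y j) \<nu>0"
proof -
  let ?P = "PiM {1..<j} (\<lambda>_. count_space UNIV \<Otimes>\<^sub>M \<nu>0) :: (nat \<Rightarrow> draw \<times> 's) measure"
  have f: "(\<lambda>\<omega>. \<lambda>l\<in>{1..<j}. (D l \<omega>, Y l \<omega>)) \<in> measurable M ?P"
    using assms by (intro measurable_restrict measurable_Pair measurable_D measurable_Y) auto
  have "(\<lambda>\<omega>. \<lambda>l\<in>{1..<j}. (D l \<omega>, Y l \<omega>)) \<in> measurable (urn_past M \<nu>0 D Y j) ?P"
    unfolding urn_past_def
    by (rule measurable_vimage_algebra1) (use measurable_space[OF f] in auto)
  moreover have "(\<lambda>h. snd (h l)) \<in> measurable ?P \<nu>0"
    using assms(1) by measurable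
  ultimately have "(\<lambda>\<omega>. snd ((\<lambda>l\<in>{1..<j}. (D l \<omega>, Y l \<omega>)) l))
      \<in> measurable (urn_past M \<nu>0 D Y j) \<nu>0"
    by (rule measurable_compose)
  then show ?thesis using assms(1) by simp
qed

lemma predictive_law:
  assumes "0 < \<theta>" "prob_space \<nu>0" "j \<in> {1..m}" "B \<in> sets \<nu>0"
  shows "AE \<omega> in M. real_cond_exp M (urn_past M \<nu>0 D Y j)
      (indicator {\<omega> \<in> space M. Y j \<omega> \<in> B}) \<omega>
    = (\<theta> * measure \<nu>0 B + (\<Sum>i\<in>{1..n}. indicator B (X i)) + (\<Sum>l\<in>{1..<j}. indicator B (Y l \<omega>)))
        / (\<theta> + real n + real j - 1)"
proof -
  let ?F = "urn_past M \<nu>0 D Y j"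
  let ?N = "\<theta> + real n + real j - 1"
  interpret nu: prob_space \<nu>0 by fact
  interpret F: finite_measure_subalgebra M ?F
    by (rule finite_measure_subalgebra_urn_past[OF assms(3)])
  note [measurable] = measurable_D[OF assms(3)] measurable_Y[OF assms(3)] assms(4)
  define fr where "fr C = (indicator {\<omega> \<in> space M. D j \<omega> = Fresh \<and> Y j \<omega> \<in> C} :: _ \<Rightarrow> real)" for C
  define ev where "ev d = (indicator {\<omega> \<in> space M. D j \<omega> = d} :: _ \<Rightarrow> real)" for d
  define g where "g C = (\<lambda>\<omega>. fr C \<omega> + ((\<Sum>i\<in>{1..n}. indicator C (X i) * ev (CopyX i) \<omega>)
     + (\<Sum>l\<in>{1..<j}. indicator C (Y l \<omega>) * ev (CopyY l) \<omega>)))" for C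
  have Npos: "?N > 0" using assms by auto
  have Yl: "Y l \<in> measurable M \<nu>0" if "l \<in> {1..<j}" for l
    using that assms(3) by (intro measurable_Y) auto
  have ifr: "integrable M (fr C)" if [measurable]: "C \<in> sets \<nu>0" for C
  proof -
    have "{\<omega> \<in> space M. D j \<omega> = Fresh \<and> Y j \<omega> \<in> C} \<in> sets M" by measurable
    then show ?thesis
      unfolding fr_def by (intro integrable_real_indicator) (auto simp: emeasure_eq_measure)
  qed
  have iev: "integrable M (ev d)" for d
  proof -
    have "{\<omega> \<in> space M. D j \<omega> = d} \<in> sets M" by measurable
    then show ?thesis
      unfolding ev_def by (intro integrable_real_indicator) (auto simp: emeasure_eq_measure)
  qed
  have iYev: "integrable M (\<lambda>\<omega>. indicator C (Y l \<omega>) * ev d \<omega>)"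
    if "C \<in> sets \<nu>0" "l \<in> {1..<j}" for C l d
  proof (rule Bochner_Integration.integrable_bound[OF iev[of d]])
    have [measurable]: "Y l \<in> measurable M \<nu>0" "C \<in> sets \<nu>0" using Yl that by auto
    have [measurable]: "ev d \<in> borel_measurable M" using iev by (rule borel_measurable_integrable)
    show "(\<lambda>\<omega>. indicator C (Y l \<omega>) * ev d \<omega>) \<in> borel_measurable M" by measurable
  qed (auto simp: ev_def indicator_def)
  let ?S = "\<lambda>C l \<omega>. if l \<in> {1..<j} then indicator C (Y l \<omega>) * ev (CopyY l) \<omega> else 0"
  have ig: "integrable M (g C)" if "C \<in> sets \<nu>0" for C
    unfolding g_def
    by (rule Bochner_Integration.integrable_add[OF ifr[OF that]
          Bochner_Integration.integrable_add[OF Bochner_Integration.integrable_sum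
            Bochner_Integration.integrable_sum]])
      (use that iYev iev in auto)
  have law: "AE \<omega> in M. real_cond_exp M ?F (g C) \<omega> = (\<theta> * measure \<nu>0 C
      + (\<Sum>i\<in>{1..n}. indicator C (X i)) + (\<Sum>l\<in>{1..<j}. indicator C (Y l \<omega>))) / ?N"
    if C: "C \<in> sets \<nu>0" for C
  proof -
    let ?a = "\<lambda>\<omega>. \<Sum>i\<in>{1..n}. indicator C (X i) * ev (CopyX i) \<omega>"
    let ?b = "\<lambda>\<omega>. \<Sum>l\<in>{1..<j}. indicator C (Y l \<omega>) * ev (CopyY l) \<omega>"
    have ia: "integrable M ?a" using iev by auto
    have ib: "integrable M ?b"
      by (rule Bochner_Integration.integrable_sum[OF iYev[OF C]])
    have "AE \<omega> in M. real_cond_exp M ?F (g C) \<omega>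
        = real_cond_exp M ?F (fr C) \<omega> + real_cond_exp M ?F (\<lambda>\<omega>. ?a \<omega> + ?b \<omega>) \<omega>"
      unfolding g_def by (rule F.real_cond_exp_add) (use ifr[OF C] ia ib in auto)
    moreover have "AE \<omega> in M. real_cond_exp M ?F (\<lambda>\<omega>. ?a \<omega> + ?b \<omega>) \<omega>
        = real_cond_exp M ?F ?a \<omega> + real_cond_exp M ?F ?b \<omega>"
      by (rule F.real_cond_exp_add[OF ia ib])
    moreover have "AE \<omega> in M. real_cond_exp M ?F ?a \<omega>
        = (\<Sum>i\<in>{1..n}. real_cond_exp M ?F (\<lambda>\<omega>. indicator C (X i) * ev (CopyX i) \<omega>) \<omega>)"
      by (rule F.real_cond_exp_sum) (use iev in auto)
    moreover have "AE \<omega> in M. \<forall>i\<in>{1..n}.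
        real_cond_exp M ?F (\<lambda>\<omega>. indicator C (X i) * ev (CopyX i) \<omega>) \<omega> = indicator C (X i) / ?N"
    proof (rule AE_finite_allI)
      fix i assume i: "i \<in> {1..n}"
      show "AE \<omega> in M. real_cond_exp M ?F (\<lambda>\<omega>. indicator C (X i) * ev (CopyX i) \<omega>) \<omega>
          = indicator C (X i) / ?N"
        using F.real_cond_exp_cmult[OF iev, of "indicator C (X i)" "CopyX i"]
          copy_X[OF assms(3) i] by (auto simp: ev_def)
    qed simp
    moreover have "AE \<omega> in M. real_cond_exp M ?F ?b \<omega>
        = (\<Sum>l\<in>{1..<j}. real_cond_exp M ?F (?S C l) \<omega>)"
    proof -
      have "?b = (\<lambda>\<omega>. \<Sum>l\<in>{1..<j}. ?S C l \<omega>)" by auto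
      moreover have "integrable M (?S C l)" for l
        using iYev[OF C] by (cases "l \<in> {1..<j}") auto
      ultimately show ?thesis using F.real_cond_exp_sum[of "?S C" "{1..<j}"] by presburger
    qed
    moreover have "AE \<omega> in M. \<forall>l\<in>{1..<j}. real_cond_exp M ?F (?S C l) \<omega> = indicator C (Y l \<omega>) / ?N"
    proof (rule AE_finite_allI)
      fix l assume l: "l \<in> {1..<j}"
      have [measurable]: "Y l \<in> measurable ?F \<nu>0" "C \<in> sets \<nu>0"
        using urn_past_Y[OF l assms(3)] C by auto
      have m1: "(\<lambda>\<omega>. indicator C (Y l \<omega>) :: real) \<in> borel_measurable ?F" by measurable
      have "AE \<omega> in M. real_cond_exp M ?F (\<lambda>\<omega>. indicator C (Y l \<omega>) * ev (CopyY l) \<omega>) \<omega>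
          = indicator C (Y l \<omega>) * real_cond_exp M ?F (ev (CopyY l)) \<omega>"
        by (rule F.real_cond_exp_mult[OF m1 _ iYev[OF C l]])
          (rule borel_measurable_integrable[OF iev])
      then show "AE \<omega> in M. real_cond_exp M ?F (?S C l) \<omega> = indicator C (Y l \<omega>) / ?N"
        using l copy_Y[OF assms(3) l] by (auto simp: ev_def)
    qed simp
    moreover have "AE \<omega> in M. real_cond_exp M ?F (fr C) \<omega> = \<theta> / ?N * measure \<nu>0 C"
      using fresh[OF assms(3) C] unfolding fr_def .
    ultimately show ?thesis
    proof eventually_elim
      case (elim \<omega>)
      have "(\<Sum>i\<in>{1..n}. real_cond_exp M ?F (\<lambda>\<omega>. indicator C (X i) * ev (CopyX i) \<omega>) \<omega>)
          = (\<Sum>i\<in>{1..n}. indicator C (X i)) / ?N"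
        using elim(4) by (simp add: sum_divide_distrib)
      moreover have "(\<Sum>l\<in>{1..<j}. real_cond_exp M ?F (?S C l) \<omega>)
          = (\<Sum>l\<in>{1..<j}. indicator C (Y l \<omega>)) / ?N"
        using elim(6) by (simp add: sum_divide_distrib)
      ultimately show ?case
        using elim(1,2,3,5,7) by (simp add: add_divide_distrib)
    qed
  qed
  have only: "ev d \<omega> = (if d = D j \<omega> then 1 else 0)" if "\<omega> \<in> space M" for d \<omega>
    using that by (auto simp: ev_def)
  have X_sum: "(\<Sum>i\<in>{1..n}. h i * ev (CopyX i) \<omega>)
      = (case D j \<omega> of CopyX i \<Rightarrow> if i \<in> {1..n} then h i else 0 | _ \<Rightarrow> 0)"
    if "\<omega> \<in> space M" for h :: "nat \<Rightarrow> real" and \<omega>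
    using that by (cases "D j \<omega>") (simp_all add: only if_distrib sum.delta cong: if_cong)
  have Y_sum: "(\<Sum>l\<in>{1..<j}. h l * ev (CopyY l) \<omega>)
      = (case D j \<omega> of CopyY l \<Rightarrow> if l \<in> {1..<j} then h l else 0 | _ \<Rightarrow> 0)"
    if "\<omega> \<in> space M" for h :: "nat \<Rightarrow> real" and \<omega>
    using that by (cases "D j \<omega>") (simp_all add: only if_distrib sum.delta cong: if_cong)
  define T where "T = (\<lambda>\<omega>. ev Fresh \<omega> + ((\<Sum>i\<in>{1..n}. 1 * ev (CopyX i) \<omega>)
      + (\<Sum>l\<in>{1..<j}. 1 * ev (CopyY l) \<omega>)))"
  have iT: "integrable M T" unfolding T_def using iev by auto
  have T_le: "T \<omega> \<le> 1" if "\<omega> \<in> space M" for \<omega>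
    unfolding T_def X_sum[OF that] Y_sum[OF that] using that
    by (cases "D j \<omega>") (auto simp: only)
  have "expectation T = 1"
  proof -
    have e1: "expectation (ev Fresh) = \<theta> / ?N"
    proof -
      have "ev Fresh = fr (space \<nu>0)"
        using measurable_space[OF measurable_Y[OF assms(3)]]
        by (auto simp: ev_def fr_def indicator_def fun_eq_iff)
      then have "expectation (ev Fresh) = expectation (real_cond_exp M ?F (fr (space \<nu>0)))"
        using F.real_cond_exp_int(2)[OF ifr[OF sets.top]] by simp
      also have "\<dots> = expectation (\<lambda>_. \<theta> / ?N)"
        by (rule integral_cong_AE)
          (use fresh[OF assms(3) sets.top] in \<open>auto simp: fr_def nu.prob_space\<close>)
      finally show ?thesis by (simp add: prob_space)
    qed
    have e2: "expectation (ev d) = 1 / ?N"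
      if "AE \<omega> in M. real_cond_exp M ?F (ev d) \<omega> = 1 / ?N" for d
    proof -
      have "expectation (ev d) = expectation (real_cond_exp M ?F (ev d))"
        using F.real_cond_exp_int(2)[OF iev] by simp
      also have "\<dots> = expectation (\<lambda>_. 1 / ?N)"
        by (rule integral_cong_AE) (use that in auto)
      finally show ?thesis by (simp add: prob_space)
    qed
    have "expectation T = expectation (ev Fresh) + ((\<Sum>i\<in>{1..n}. expectation (ev (CopyX i)))
        + (\<Sum>l\<in>{1..<j}. expectation (ev (CopyY l))))"
      unfolding T_def using iev by simp
    also have "\<dots> = \<theta> / ?N + ((\<Sum>i\<in>{1..n}. 1 / ?N) + (\<Sum>l\<in>{1..<j}. 1 / ?N))"
      using e1 e2 copy_X[OF assms(3)] copy_Y[OF assms(3)] by (simp add: ev_def)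
    also have "\<dots> = ?N / ?N"
    proof -
      have "real (j - 1) = real j - 1" using assms(3) by (auto simp: of_nat_diff)
      then show ?thesis by (simp flip: add_divide_distrib add: algebra_simps)
    qed
    finally show ?thesis using Npos by simp
  qed
  then have "expectation (\<lambda>\<omega>. 1 - T \<omega>) = 0" using iT by (simp add: prob_space)
  then have T1: "AE \<omega> in M. T \<omega> = 1"
    using integral_nonneg_eq_0_iff_AE[of M "\<lambda>\<omega>. 1 - T \<omega>"] iT T_le by auto
  have "AE \<omega> in M. \<forall>i\<in>{1..n}. D j \<omega> = CopyX i \<longrightarrow> Y j \<omega> = X i"
    using value_X[OF assms(3)] by (intro AE_finite_allI) auto
  moreover have "AE \<omega> in M. \<forall>l\<in>{1..<j}. D j \<omega> = CopyY l \<longrightarrow> Y j \<omega> = Y l \<omega>"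
    using value_Y[OF assms(3)] by (intro AE_finite_allI) auto
  ultimately have "AE \<omega> in M. indicator {\<omega> \<in> space M. Y j \<omega> \<in> B} \<omega> = g B \<omega>"
    using T1 AE_space
  proof eventually_elim
    case (elim \<omega>)
    then show ?case
      unfolding g_def T_def X_sum[OF elim(4)] Y_sum[OF elim(4)]
      by (cases "D j \<omega>") (auto simp: only fr_def indicator_def split: if_splits)
  qed
  then have "AE \<omega> in M. real_cond_exp M ?F (indicator {\<omega> \<in> space M. Y j \<omega> \<in> B}) \<omega>
      = real_cond_exp M ?F (g B) \<omega>"
    by (rule F.real_cond_exp_cong) (use ig[OF assms(4)] in measurable)
  then show ?thesis using law[OF assms(4)] by auto
qed

end

end

theory Submission
  imports Defs
begin

text \<open>
  Every chain of copies that ends in \<open>X i\<close> contains a direct copy of \<open>X i\<close>, so \<open>R\<close> counts the indices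
  that are copied directly. Given the past of step \<open>k + 1\<close>, a new index is therefore drawn with
  probability \<open>(n - R) / (\<theta> + n + k)\<close>: the number of indices is a Markov chain in \<open>k\<close>, and the formula
  solves its recursion.
\<close>

section \<open>Reduction of origins to direct copies\<close>

lemma originates_imp_CopyX:
  assumes "originates d j i" "1 \<le> j"
  shows "\<exists>l\<in>{1..j}. d l = CopyX i"
  using assms by induction force+

text \<open>Unlike \<open>originates\<close>, membership tests each choice separately, without
  chains; this makes measurability and the one-step update easy.\<close>

definition copied :: "nat \<Rightarrow> nat \<Rightarrow> (nat \<Rightarrow> draw) \<Rightarrow> nat set" where
  "copied n k d = {i \<in> {1..n}. \<exists>j\<in>{1..k}. d j = CopyX i}"

lemma finite_copied [simp]: "finite (copied n k d)"
  by (simp add: copied_def)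

lemma copied_subset: "copied n k d \<subseteq> {1..n}"
  by (auto simp: copied_def)

lemma num_origins_eq_card_copied: "num_origins n k d = card (copied n k d)"
proof -
  \<comment> \<open>A chain runs backwards in time, so the direct copy at its end is again among the
    first \<open>k\<close> draws.\<close>
  have "(\<exists>j\<in>{1..k}. originates d j i) \<longleftrightarrow> (\<exists>j\<in>{1..k}. d j = CopyX i)" for i
    by (meson atLeastAtMost_iff copy_of_X le_trans originates_imp_CopyX)
  then show ?thesis
    by (simp add: num_origins_def copied_def)
qed

text \<open>A draw copies at most one \<open>X i\<close>, and repeating an index already copied
  changes nothing, so the set grows by at most one element.\<close>

lemma card_copied_Suc:
  "card (copied n (Suc k) d) = card (copied n k d)
     + (if \<exists>i\<in>{1..n} - copied n k d. d (Suc k) = CopyX i then 1 else 0)"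
proof (cases "\<exists>i\<in>{1..n} - copied n k d. d (Suc k) = CopyX i")
  case True
  then obtain i where i: "i \<in> {1..n}" "i \<notin> copied n k d" "d (Suc k) = CopyX i" by auto
  then have "copied n (Suc k) d = insert i (copied n k d)"
    by (auto simp: copied_def atLeastAtMostSuc_conv)
  then show ?thesis using True i(2) by simp
next
  case False
  then have "copied n (Suc k) d = copied n k d"
    by (auto simp: copied_def atLeastAtMostSuc_conv)
  then show ?thesis using False by simp
qed

section \<open>Algebra of the weights\<close>

lemma falling_of_nat: "falling (real n) r = fact r * real (n choose r)"
  by (simp add: falling_def binomial_gbinomial gbinomial_prod_rev lessThan_atLeast0)

text \<open>
  The normalised solution of the recursion; the truncated \<open>k - r\<close> is harmless because the binomial
  coefficient vanishes for \<open>k < r\<close>.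
\<close>

definition weight :: "real \<Rightarrow> nat \<Rightarrow> nat \<Rightarrow> nat \<Rightarrow> real" where
  "weight \<theta> n k r = falling (real n) r * pochhammer (\<theta> + real r) (k - r) * real (k choose r)"

lemma weight_Suc_0: "weight \<theta> n (Suc k) 0 = (\<theta> + real k) * weight \<theta> n k 0"
  by (simp add: weight_def pochhammer_Suc)

text \<open>This is the transition equation of the chain multiplied by the denominators:
  \<open>\<theta> + k + Suc r\<close> is the mass of the draws that keep the count
  \<open>Suc r\<close>, and \<open>n - r\<close> the mass of those that raise it from
  \<open>r\<close>. For \<open>r < k\<close> all terms share the factor \<open>F * P\<close>, and a
  binomial identity remains.\<close>

lemma weight_Suc_Suc:
  "weight \<theta> n (Suc k) (Suc r)
     = (\<theta> + real k + real (Suc r)) * weight \<theta> n k (Suc r) + (real n - real r) * weight \<theta> n k r"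
proof (cases "r < k")
  case True
  define l where "l = k - Suc r"
  have kl: "k = Suc (r + l)" using True by (simp add: l_def)
  \<comment> \<open>Both sides equal \<open>k * (k - 1 choose r)\<close>; here \<open>Suc l\<close>
    is \<open>k - r\<close>.\<close>
  have "Suc r * (k choose Suc r) = Suc l * (k choose r)"
    using binomial_absorb_comp[of k r] binomial_absorption[of r k]
    by (simp add: kl mult.commute)
  then have b: "(real r + 1) * real (k choose Suc r) = (real l + 1) * real (k choose r)"
    by (metis of_nat_Suc of_nat_mult add.commute)
  define P where "P = pochhammer (\<theta> + real r + 1) l"
  define F where "F = falling (real n) r * (real n - real r)"
  have f: "falling (real n) (Suc r) = F"
    by (simp add: falling_def F_def)
  \<comment> \<open>\<open>p\<close> splits off the last factor, which is
    \<open>\<theta> + k\<close> because \<open>k = r + l + 1\<close>; \<open>q\<close> splits off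
    the first.\<close>
  have p: "pochhammer (\<theta> + real (Suc r)) (Suc l) = P * (\<theta> + real k)"
    by (simp add: pochhammer_Suc P_def kl algebra_simps)
  have q: "pochhammer (\<theta> + real r) (Suc l) = (\<theta> + real r) * P"
    by (simp add: pochhammer_rec P_def algebra_simps)
  have w1: "weight \<theta> n (Suc k) (Suc r)
      = F * P * (\<theta> + real k) * (real (k choose r) + real (k choose Suc r))"
    using p f by (simp add: weight_def kl )
  have w2: "weight \<theta> n k (Suc r) = F * P * real (k choose Suc r)"
    using f by (simp add: weight_def kl P_def algebra_simps)
  have w3: "(real n - real r) * weight \<theta> n k r = F * P * (\<theta> + real r) * real (k choose r)"
    using q by (simp add: weight_def kl F_def)
  have "(\<theta> + real k) * (real (k choose r) + real (k choose Suc r))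
      = (\<theta> + real k + real (Suc r)) * real (k choose Suc r) + (\<theta> + real r) * real (k choose r)"
    using b kl by (simp add: algebra_simps)
  then have "F * P * ((\<theta> + real k) * (real (k choose r) + real (k choose Suc r)))
      = F * P * ((\<theta> + real k + real (Suc r)) * real (k choose Suc r) + (\<theta> + real r) * real (k choose r))"
    by simp
  then show ?thesis
    unfolding w1 w2 w3 by (simp add: algebra_simps)
next
  case False
  \<comment> \<open>For \<open>r = k\<close> only the term of \<open>weight\<close> at
    \<open>r\<close> survives on the right, and \<open>falling\<close> gains the factor
    \<open>n - r\<close>; for \<open>k < r\<close> every binomial coefficient is zero.\<close>
  then consider "r = k" | "k < r" by linarith
  then show ?thesis
    by cases (simp_all add: weight_def falling_def binomial_eq_0)
qed

section \<open>Law of the number of copied indices\<close>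

context polya_urn
begin

text \<open>Needed so that events about the indices copied so far belong to the past.\<close>

lemma urn_past_D:
  assumes "l \<in> {1..<j}" "j \<in> {1..m}"
  shows "D l \<in> measurable (urn_past M \<nu>0 D Y j) (count_space UNIV)"
proof -
  let ?P = "PiM {1..<j} (\<lambda>_. count_space UNIV \<Otimes>\<^sub>M \<nu>0) :: (nat \<Rightarrow> draw \<times> 's) measure"
  have f: "(\<lambda>\<omega>. \<lambda>l\<in>{1..<j}. (D l \<omega>, Y l \<omega>)) \<in> measurable M ?P"
    using assms by (intro measurable_restrict measurable_Pair measurable_D measurable_Y) auto
  have "(\<lambda>\<omega>. \<lambda>l\<in>{1..<j}. (D l \<omega>, Y l \<omega>)) \<in> measurable (urn_past M \<nu>0 D Y j) ?P"
    unfolding urn_past_def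
    by (rule measurable_vimage_algebra1) (use measurable_space[OF f] in auto)
  moreover have "(\<lambda>h. fst (h l)) \<in> measurable ?P (count_space UNIV)"
    using assms(1) by measurable
  ultimately have "(\<lambda>\<omega>. fst ((\<lambda>l\<in>{1..<j}. (D l \<omega>, Y l \<omega>)) l))
      \<in> measurable (urn_past M \<nu>0 D Y j) (count_space UNIV)"
    by (rule measurable_compose)
  then show ?thesis using assms(1) by simp
qed

text \<open>The conditional probability in \<open>copy_X\<close> is constant, so integrating it over
  a past event \<open>A\<close> multiplies \<open>prob A\<close> by that constant.\<close>

lemma prob_past_CopyX:
  assumes j: "j \<in> {1..m}" and i: "i \<in> {1..n}" and A: "A \<in> sets (urn_past M \<nu>0 D Y j)"
  shows "prob {\<omega> \<in> A. D j \<omega> = CopyX i} = prob A / (\<theta> + real n + real j - 1)"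
proof -
  let ?F = "urn_past M \<nu>0 D Y j"
  let ?E = "{\<omega> \<in> space M. D j \<omega> = CopyX i}"
  interpret F: finite_measure_subalgebra M ?F
    by (rule finite_measure_subalgebra_urn_past[OF j])
  note [measurable] = measurable_D[OF j]
  have AM [measurable]: "A \<in> sets M" using A F.subalg by (auto simp: subalgebra_def)
  have E: "?E \<in> sets M" by measurable
  have iE: "integrable M (indicator ?E :: _ \<Rightarrow> real)"
    using E by (intro integrable_real_indicator) (auto simp: emeasure_eq_measure)
  have "{\<omega> \<in> A. D j \<omega> = CopyX i} = A \<inter> ?E" using sets.sets_into_space[OF AM] by auto
  then have "prob {\<omega> \<in> A. D j \<omega> = CopyX i} = expectation (indicator (A \<inter> ?E))"
    using AM E by simp
  also have "\<dots> = (\<integral>\<omega>\<in>A. indicator ?E \<omega> \<partial>M)"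
    unfolding set_lebesgue_integral_def
    by (intro Bochner_Integration.integral_cong) (auto simp: indicator_def)
  also have "\<dots> = (\<integral>\<omega>\<in>A. real_cond_exp M ?F (indicator ?E) \<omega> \<partial>M)"
    by (rule F.real_cond_exp_intA[OF iE A])
  also have "\<dots> = (\<integral>\<omega>\<in>A. 1 / (\<theta> + real n + real j - 1) \<partial>M)"
    unfolding set_lebesgue_integral_def
    by (rule integral_cong_AE) (use copy_X[OF j i] in auto)
  also have "\<dots> = prob A / (\<theta> + real n + real j - 1)"
    using AM by (simp add: set_lebesgue_integral_def)
  finally show ?thesis .
qed

text \<open>The space \<open>N\<close> is left general so that the result applies both to
  \<open>M\<close> and to the past of a step. The cardinality event is a finite disjunction over the
  possible sets \<open>S\<close> of copied indices.\<close>

lemma pred_card_copied: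
  assumes D: "\<And>j. j \<in> {1..k} \<Longrightarrow> D j \<in> measurable N (count_space UNIV)"
  shows "Measurable.pred N (\<lambda>\<omega>. card (copied n k (\<lambda>j. D j \<omega>)) = r)"
    and "Measurable.pred N (\<lambda>\<omega>. i \<in> copied n k (\<lambda>j. D j \<omega>))"
proof -
  have ex [measurable]: "Measurable.pred N (\<lambda>\<omega>. \<exists>j\<in>{1..k}. D j \<omega> = CopyX i)" for i
    using D by (intro pred_intros_finite pred_eq_const1) auto
  show "Measurable.pred N (\<lambda>\<omega>. i \<in> copied n k (\<lambda>j. D j \<omega>))"
    unfolding copied_def mem_Collect_eq by measurable
  have "card (copied n k d) = r \<longleftrightarrow>
      (\<exists>S\<in>{S \<in> Pow {1..n}. card S = r}. \<forall>i\<in>{1..n}. i \<in> S \<longleftrightarrow> (\<exists>j\<in>{1..k}. d j = CopyX i))" for d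
  proof
    assume "card (copied n k d) = r"
    then show "\<exists>S\<in>{S \<in> Pow {1..n}. card S = r}. \<forall>i\<in>{1..n}. i \<in> S \<longleftrightarrow> (\<exists>j\<in>{1..k}. d j = CopyX i)"
      by (intro bexI[of _ "copied n k d"]) (auto simp: copied_def)
  next
    assume "\<exists>S\<in>{S \<in> Pow {1..n}. card S = r}. \<forall>i\<in>{1..n}. i \<in> S \<longleftrightarrow> (\<exists>j\<in>{1..k}. d j = CopyX i)"
    then obtain S where S: "S \<subseteq> {1..n}" "card S = r"
      "\<forall>i\<in>{1..n}. i \<in> S \<longleftrightarrow> (\<exists>j\<in>{1..k}. d j = CopyX i)" by auto
    then have "copied n k d = S" by (auto simp: copied_def)
    then show "card (copied n k d) = r" using S by simp
  qed
  then show "Measurable.pred N (\<lambda>\<omega>. card (copied n k (\<lambda>j. D j \<omega>)) = r)"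
    by (simp only:) (intro pred_intros_finite pred_intros_logic ex finite_Collect_conjI; simp)
qed

lemma prob_new_index:
  assumes k: "k < m"
  shows "prob {\<omega> \<in> space M. card (copied n k (\<lambda>j. D j \<omega>)) = r
        \<and> (\<exists>i\<in>{1..n} - copied n k (\<lambda>j. D j \<omega>). D (Suc k) \<omega> = CopyX i)}
      = (real n - real r) / (\<theta> + real n + real k)
          * prob {\<omega> \<in> space M. card (copied n k (\<lambda>j. D j \<omega>)) = r}"
proof -
  let ?c = "\<lambda>\<omega>. copied n k (\<lambda>j. D j \<omega>)"
  let ?F = "urn_past M \<nu>0 D Y (Suc k)"
  let ?N = "\<theta> + real n + real k"
  let ?K = "{\<omega> \<in> space M. card (?c \<omega>) = r}"
  \<comment> \<open>The new index \<open>i\<close> is random, so the event is split by its value;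
    each \<open>A i\<close> lies in the past, where \<open>prob_past_CopyX\<close> applies.\<close>
  define A where "A i = {\<omega> \<in> space M. card (?c \<omega>) = r \<and> i \<notin> ?c \<omega>}" for i
  have j: "Suc k \<in> {1..m}" using k by auto
  interpret F: finite_measure_subalgebra M ?F
    by (rule finite_measure_subalgebra_urn_past[OF j])
  have [measurable]: "Measurable.pred M (\<lambda>\<omega>. card (?c \<omega>) = r)"
    using k by (intro pred_card_copied measurable_D) auto
  have [measurable]: "Measurable.pred ?F (\<lambda>\<omega>. card (?c \<omega>) = r)"
      "\<And>i. Measurable.pred ?F (\<lambda>\<omega>. i \<in> ?c \<omega>)"
    using j by (intro pred_card_copied urn_past_D; auto)+
  have F_space: "space M = space ?F"
    using F.subalg by (simp add: subalgebra_def)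
  have A: "A i \<in> sets ?F" for i
    unfolding A_def F_space by measurable
  have AM [measurable]: "A i \<in> sets M" for i
    using A F.subalg by (auto simp: subalgebra_def)
  note [measurable] = measurable_D[OF j]
  have "{\<omega> \<in> space M. card (?c \<omega>) = r \<and> (\<exists>i\<in>{1..n} - ?c \<omega>. D (Suc k) \<omega> = CopyX i)}
      = (\<Union>i\<in>{1..n}. {\<omega> \<in> A i. D (Suc k) \<omega> = CopyX i})"
    by (auto simp: A_def)
  also have "prob \<dots> = (\<Sum>i\<in>{1..n}. prob {\<omega> \<in> A i. D (Suc k) \<omega> = CopyX i})"
  proof (rule finite_measure_finite_Union)
    have "{\<omega> \<in> A i. D (Suc k) \<omega> = CopyX i} = A i \<inter> {\<omega> \<in> space M. D (Suc k) \<omega> = CopyX i}" for i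
      by (auto simp: A_def)
    then show "(\<lambda>i. {\<omega> \<in> A i. D (Suc k) \<omega> = CopyX i}) ` {1..n} \<subseteq> sets M" by auto
  qed (auto simp: disjoint_family_on_def)
  also have "\<dots> = (\<Sum>i\<in>{1..n}. prob (A i)) / ?N"
    unfolding sum_divide_distrib
    by (intro sum.cong refl) (simp add: prob_past_CopyX[OF j _ A] add.assoc)
  \<comment> \<open>The sum of the indicators counts the indices not yet copied: it is
    \<open>n - r\<close> on \<open>?K\<close> and zero elsewhere.\<close>
  also have "(\<Sum>i\<in>{1..n}. prob (A i)) = expectation (\<lambda>\<omega>. \<Sum>i\<in>{1..n}. indicator (A i) \<omega>)"
    using AM by (subst Bochner_Integration.integral_sum) (auto simp: emeasure_eq_measure)
  also have "\<dots> = expectation (\<lambda>\<omega>. (real n - real r) * indicator ?K \<omega>)"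
  proof (rule Bochner_Integration.integral_cong)
    fix \<omega> assume w: "\<omega> \<in> space M"
    have "(\<Sum>i\<in>{1..n}. indicator (A i) \<omega>)
        = (if card (?c \<omega>) = r then \<Sum>i\<in>{1..n}. indicator (- ?c \<omega>) i else (0 :: real))"
      using w by (auto simp: A_def indicator_def intro!: sum.cong)
    also have "(\<Sum>i\<in>{1..n}. indicator (- ?c \<omega>) i) = real (card ({1..n} - ?c \<omega>))"
      by (simp add: indicator_def Diff_eq Compl_eq)
    also have "\<dots> = real n - real (card (?c \<omega>))"
      using copied_subset[of n k] card_mono[OF _ copied_subset[of n k]]
      by (subst card_Diff_subset) (auto simp: of_nat_diff)
    finally show "(\<Sum>i\<in>{1..n}. indicator (A i) \<omega>) = (real n - real r) * indicator ?K \<omega>"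
      using w by (simp add: indicator_def)
  qed simp
  also have "\<dots> = (real n - real r) * prob ?K"
    by simp
  finally show ?thesis by simp
qed

lemma prob_card_copied:
  assumes \<theta>: "0 < \<theta>" and "k \<le> m"
  shows "prob {\<omega> \<in> space M. card (copied n k (\<lambda>j. D j \<omega>)) = r}
      = weight \<theta> n k r / pochhammer (\<theta> + real n) k"
  using \<open>k \<le> m\<close>
proof (induction k arbitrary: r)
  case 0
  then show ?case
    by (cases r) (auto simp: copied_def weight_def falling_def prob_space)
next
  case (Suc k)
  let ?c = "\<lambda>\<omega>. copied n k (\<lambda>j. D j \<omega>)"
  define new where "new \<omega> \<longleftrightarrow> (\<exists>i\<in>{1..n} - ?c \<omega>. D (Suc k) \<omega> = CopyX i)" for \<omega>
  let ?K = "\<lambda>r. {\<omega> \<in> space M. card (?c \<omega>) = r}"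
  let ?E = "\<lambda>r. {\<omega> \<in> space M. card (?c \<omega>) = r \<and> new \<omega>}"
  let ?N = "\<theta> + real n + real k"
  let ?P = "pochhammer (\<theta> + real n) k"
  have N: "?N > 0" using \<theta> by simp
  have PS: "pochhammer (\<theta> + real n) (Suc k) = ?P * ?N"
    by (simp add: pochhammer_Suc)
  have IH: "prob (?K r) = weight \<theta> n k r / ?P" for r using Suc by simp
  have [measurable]: "Measurable.pred M (\<lambda>\<omega>. card (?c \<omega>) = r)"
      "\<And>i. Measurable.pred M (\<lambda>\<omega>. i \<in> ?c \<omega>)" for r
    using Suc.prems by (intro pred_card_copied measurable_D; auto)+
  have [measurable]: "D (Suc k) \<in> measurable M (count_space UNIV)"
    using Suc.prems by (intro measurable_D) auto
  have new_iff: "new \<omega> \<longleftrightarrow> (\<exists>i\<in>{1..n}. i \<notin> ?c \<omega> \<and> D (Suc k) \<omega> = CopyX i)" for \<omega>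
    by (auto simp: new_def)
  have K_sets: "?K r \<in> sets M" and E_sets: "?E r \<in> sets M" for r
    unfolding new_iff by measurable
  have E: "prob (?E r) = (real n - real r) / ?N * (weight \<theta> n k r / ?P)" for r
    using prob_new_index[of k r] Suc.prems IH by (simp add: new_def)
  \<comment> \<open>The mass \<open>\<theta> + k + r\<close> belongs to a fresh draw, the
    \<open>k\<close> earlier \<open>Y\<close>s and the \<open>r\<close> indices already copied. It
    is obtained here as a complement, from \<open>copy_X\<close> alone.\<close>
  have old: "prob (?K r - ?E r) = (\<theta> + real k + real r) / ?N * (weight \<theta> n k r / ?P)" for r
  proof -
    have "prob (?K r - ?E r) = prob (?K r) - prob (?E r)"
      by (rule finite_measure_Diff[OF K_sets E_sets]) auto
    also have "\<dots> = (1 - (real n - real r) / ?N) * (weight \<theta> n k r / ?P)"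
      unfolding E IH by (simp only: left_diff_distrib mult_1_left)
    also have "1 - (real n - real r) / ?N = (\<theta> + real k + real r) / ?N"
      using N by (simp add: field_simps)
    finally show ?thesis .
  qed
  have step: "card (copied n (Suc k) (\<lambda>j. D j \<omega>)) = card (?c \<omega>) + (if new \<omega> then 1 else 0)" for \<omega>
    unfolding new_def by (rule card_copied_Suc)
  show ?case
  proof (cases r)
    case 0
    have "{\<omega> \<in> space M. card (copied n (Suc k) (\<lambda>j. D j \<omega>)) = r} = ?K 0 - ?E 0"
      by (auto simp: step 0)
    then show ?thesis
      unfolding 0 PS weight_Suc_0 using old[of 0] by (simp add: mult.commute)
  next
    case (Suc s)
    \<comment> \<open>The count is \<open>r = Suc s\<close> after the step if it was
      \<open>r\<close> and no new index came, or was \<open>s\<close> and one came.\<close>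
    have eq: "{\<omega> \<in> space M. card (copied n (Suc k) (\<lambda>j. D j \<omega>)) = r} = (?K r - ?E r) \<union> ?E s"
      by (auto simp: step Suc)
    have "prob ((?K r - ?E r) \<union> ?E s) = prob (?K r - ?E r) + prob (?E s)"
      by (rule finite_measure_Union[OF sets.Diff[OF K_sets E_sets] E_sets]) (use Suc in force)
    also have "\<dots> = ((\<theta> + real k + real r) * weight \<theta> n k r + (real n - real s) * weight \<theta> n k s)
        / (?P * ?N)"
      unfolding old E by (simp only: times_divide_times_eq add_divide_distrib[symmetric] mult.commute[of ?N ?P])
    also have "\<dots> = weight \<theta> n (Suc k) r / (?P * ?N)"
      unfolding Suc weight_Suc_Suc ..
    finally show ?thesis unfolding PS eq .
  qed
qed

end

theorem theorem3p1:
  fixes M :: "'w measure" and \<theta> :: real and \<nu>0 :: "'s measure"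
    and n m r :: nat and X :: "nat \<Rightarrow> 's"
    and D :: "nat \<Rightarrow> 'w \<Rightarrow> draw" and Y :: "nat \<Rightarrow> 'w \<Rightarrow> 's"
  assumes "0 < \<theta>"
    and "prob_space \<nu>0"
    and "\<And>i. i \<in> {1..n} \<Longrightarrow> X i \<in> space \<nu>0"
    and "polya_urn M \<theta> \<nu>0 n X m D Y"
    and "r \<le> min n m"
  shows "measure M {\<omega> \<in> space M. num_origins n m (\<lambda>j. D j \<omega>) = r}
        = falling (real n) r * pochhammer (\<theta> + real r) (m - r) / pochhammer (\<theta> + real n) m
            * real (m choose r)
    \<and> measure M {\<omega> \<in> space M. num_origins n m (\<lambda>j. D j \<omega>) = r}
        = fact r * real (n choose r) * real (m choose r)
            * (pochhammer \<theta> n * pochhammer \<theta> m / (pochhammer \<theta> (n + m) * pochhammer \<theta> r))"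
proof -
  interpret polya_urn M \<theta> \<nu>0 n X m D Y by fact
  let ?p = "measure M {\<omega> \<in> space M. num_origins n m (\<lambda>j. D j \<omega>) = r}"
  have p: "?p = falling (real n) r * pochhammer (\<theta> + real r) (m - r) / pochhammer (\<theta> + real n) m
      * real (m choose r)"
    unfolding num_origins_eq_card_copied prob_card_copied[OF \<open>0 < \<theta>\<close> order_refl] weight_def
    by simp
  have pos: "pochhammer \<theta> n > 0" "pochhammer \<theta> r > 0"
    using \<open>0 < \<theta>\<close> by (auto intro: pochhammer_pos)
  \<comment> \<open>Split \<open>pochhammer \<theta> m\<close> after \<open>r\<close> factors, which
    uses \<open>r \<le> m\<close>, and \<open>pochhammer \<theta> (n + m)\<close> after
    \<open>n\<close> factors; then cancel.\<close>
  have "pochhammer \<theta> n * pochhammer \<theta> m / (pochhammer \<theta> (n + m) * pochhammer \<theta> r)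
      = pochhammer (\<theta> + real r) (m - r) / pochhammer (\<theta> + real n) m"
    using pos pochhammer_product[of r m \<theta>] assms(5) by (simp add: pochhammer_product')
  then show ?thesis
    using p by (simp add: falling_of_nat)
qed

end
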